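(* Assume Conjecture A (stated in the context). Then there is an algorithm which takes as input a Diophantine equation $D(x_1,\ldots,x_p)=0$ with $D\in\mathbb{Z}[x_1,\ldots,x_p]$ and returns an integer $b$ with the following property: if the equation $D(x_1,\ldots,x_p)=0$ has only finitely many solutions in positive integers, then every solution $(x_1,\ldots,x_p)$ in positive integers satisfies $x_1,\ldots,x_p\leqslant b$.
   Context: For a positive integer $n$, let $G_n=\{x_i\cdot x_j=x_k : i,j,k\in\{1,\ldots,n\}\}\cup\{x_i+1=x_k : i,k\in\{1,\ldots,n\}\}$, a set of equations in the variables $x_1,\ldots,x_n$. Define $f(1)=1$ and $f(n+1)=2^{2^{f(n)}}$ for every positive integer $n$. Conjecture A: for every positive integer $n$, if a system $\mathcal{S}\subseteq G_n$ has only finitely many solutions in non-negative integers $x_1,\ldots,x_n$, then each such solution $(x_1,\ldots,x_n)$ satisfies $x_1,\ldots,x_n\leqslant f(2n)$. A Diophantine equation is an equation $D(x_1,\ldots,x_p)=0$ with $p\geqslant 1$ and $D\in\mathbb{Z}[x_1,\ldots,x_p]$; the list of variables $x_1,\ldots,x_p$ is part of the data. *)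

theory Defs
  imports
    "HOL-Library.Poly_Mapping"
    "HOL-Library.Nat_Bijection"
    "HOL-Library.FuncSet"
begin

subsection \<open>Computability\<close>

text \<open>The libraries imported here have no model of computation, so algorithms are
  rendered as the standard partial recursive functions: programs are the terms of type
  \<open>recf\<close>, and \<open>rec_eval r xs y\<close> says that program \<open>r\<close> halts on the argument tuple
  \<open>xs\<close> with result \<open>y\<close>. Primitive recursion and minimisation run over the first argument.\<close>

datatype recf =
    Zero
  | Successor
  | Proj nat
  | Comp recf "recf list"
  | PrimRec recf recf
  | Mu recf

inductive rec_eval :: "recf \<Rightarrow> nat list \<Rightarrow> nat \<Rightarrow> bool" where
  Zero: "rec_eval Zero xs 0"
| Successor: "rec_eval Successor [x] (Suc x)"
| Proj: "i < length xs \<Longrightarrow> rec_eval (Proj i) xs (xs ! i)"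
| Comp: "list_all2 (\<lambda>g y. rec_eval g xs y) gs ys \<Longrightarrow> rec_eval f ys z \<Longrightarrow>
    rec_eval (Comp f gs) xs z"
| PrimRec_0: "rec_eval f xs z \<Longrightarrow> rec_eval (PrimRec f g) (0 # xs) z"
| PrimRec_Suc: "rec_eval (PrimRec f g) (n # xs) y \<Longrightarrow> rec_eval g (n # y # xs) z \<Longrightarrow>
    rec_eval (PrimRec f g) (Suc n # xs) z"
| Mu: "rec_eval f (n # xs) 0 \<Longrightarrow> (\<forall>m<n. \<exists>y. 0 < y \<and> rec_eval f (m # xs) y) \<Longrightarrow>
    rec_eval (Mu f) xs n"

lemma rec_eval_deterministic:
  "rec_eval r xs y \<Longrightarrow> rec_eval r xs z \<Longrightarrow> y = z"
proof (induction r xs y arbitrary: z rule: rec_eval.induct)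
  case (Zero xs)
  then show ?case by (auto elim: rec_eval.cases)
next
  case (Successor x)
  then show ?case by (auto elim: rec_eval.cases)
next
  case (Proj i xs)
  from Proj.prems show ?case by cases auto
next
  case (Comp xs gs ys f y)
  from Comp.prems obtain ys' where
    *: "list_all2 (\<lambda>g y. rec_eval g xs y) gs ys'" "rec_eval f ys' z"
    by cases auto
  have "ys = ys'"
    using Comp.IH(1) *(1) by (auto simp: list_all2_conv_all_nth intro!: nth_equalityI)
  then show ?case using Comp.IH(2) *(2) by auto
next
  case (PrimRec_0 f xs y g)
  from PrimRec_0.prems show ?case by cases (auto dest: PrimRec_0.IH)
next
  case (PrimRec_Suc f g n xs y w)
  from PrimRec_Suc.prems obtain y' where
    *: "rec_eval (PrimRec f g) (n # xs) y'" "rec_eval g (n # y' # xs) z"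
    by cases auto
  then show ?case using PrimRec_Suc.IH by metis
next
  case (Mu f n xs)
  from Mu.prems have *: "rec_eval f (z # xs) 0"
    "\<forall>m<z. \<exists>y. 0 < y \<and> rec_eval f (m # xs) y"
    by (cases, auto)+
  have "\<not> n < z" using *(2) Mu.IH(1) by (metis less_irrefl)
  moreover have "\<not> z < n" using *(1) Mu.IH(2) by (metis less_irrefl)
  ultimately show ?case by simp
qed

text \<open>Inputs and outputs are presented to a program through numberings.\<close>

definition computable_on ::
    "'a set \<Rightarrow> ('a \<Rightarrow> nat) \<Rightarrow> ('b \<Rightarrow> nat) \<Rightarrow> ('a \<Rightarrow> 'b) \<Rightarrow> bool" where
  "computable_on A code_in code_out F \<longleftrightarrow>
     (\<exists>r. \<forall>a\<in>A. rec_eval r [code_in a] (code_out (F a)))"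


subsection \<open>The systems and the conjecture\<close>

text \<open>\<open>Mult i j k\<close> stands for the equation $x_i \cdot x_j = x_k$ and \<open>Incr i k\<close> for
  $x_i + 1 = x_k$.\<close>

datatype equation = Mult nat nat nat | Incr nat nat

fun holds :: "(nat \<Rightarrow> nat) \<Rightarrow> equation \<Rightarrow> bool" where
  "holds x (Mult i j k) \<longleftrightarrow> x i * x j = x k"
| "holds x (Incr i k) \<longleftrightarrow> x i + 1 = x k"

definition G_system :: "nat \<Rightarrow> equation set" where
  "G_system n = {Mult i j k | i j k. i \<in> {1..n} \<and> j \<in> {1..n} \<and> k \<in> {1..n}}
       \<union> {Incr i k | i k. i \<in> {1..n} \<and> k \<in> {1..n}}"

text \<open>Tuples $(x_1,\ldots,x_n)$ are extensional functions on \<open>{1..n}\<close>, so that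
  cardinalities of solution sets count tuples.\<close>

definition nat_solutions :: "nat \<Rightarrow> equation set \<Rightarrow> (nat \<Rightarrow> nat) set" where
  "nat_solutions n S = {x \<in> {1..n} \<rightarrow>\<^sub>E UNIV. \<forall>e\<in>S. holds x e}"

text \<open>Only arguments $n \geq 1$ matter; the value at \<open>0\<close> is a dummy.\<close>

fun f_bound :: "nat \<Rightarrow> nat" where
  "f_bound 0 = 1"
| "f_bound (Suc 0) = 1"
| "f_bound (Suc (Suc n)) = 2 ^ (2 ^ f_bound (Suc n))"

definition conjecture_A :: bool where
  "conjecture_A \<longleftrightarrow>
     (\<forall>n\<ge>1. \<forall>S\<subseteq>G_system n. finite (nat_solutions n S) \<longrightarrow>
        (\<forall>x\<in>nat_solutions n S. \<forall>i\<in>{1..n}. x i \<le> f_bound (2 * n)))"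


subsection \<open>Diophantine equations\<close>

text \<open>A monomial is its finitely supported exponent function, a polynomial its finitely
  supported coefficient function; the variable $x_i$ has index \<open>i\<close>.\<close>

type_synonym int_mpoly = "(nat \<Rightarrow>\<^sub>0 nat) \<Rightarrow>\<^sub>0 int"

definition eval_mpoly :: "int_mpoly \<Rightarrow> (nat \<Rightarrow> int) \<Rightarrow> int" where
  "eval_mpoly D x =
     (\<Sum>m\<in>Poly_Mapping.keys D.
        Poly_Mapping.lookup D m * (\<Prod>i\<in>Poly_Mapping.keys m. x i ^ Poly_Mapping.lookup m i))"

text \<open>The pair \<open>(p, D)\<close> is the equation $D(x_1,\ldots,x_p) = 0$ with
  $D \in \mathbb{Z}[x_1,\ldots,x_p]$; not every variable needs to occur in \<open>D\<close>.\<close>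

definition diophantine_equations :: "(nat \<times> int_mpoly) set" where
  "diophantine_equations =
     {(p, D). p \<ge> 1 \<and> (\<forall>m\<in>Poly_Mapping.keys D. Poly_Mapping.keys m \<subseteq> {1..p})}"

fun pos_solutions :: "nat \<times> int_mpoly \<Rightarrow> (nat \<Rightarrow> int) set" where
  "pos_solutions (p, D) = {x \<in> {1..p} \<rightarrow>\<^sub>E {1..}. eval_mpoly D x = 0}"

text \<open>The code of an equation lists \<open>p\<close> and all nonzero terms, each term as its exponent
  vector of length \<open>p\<close> with its coefficient. Sorting the numbers of the terms
  makes the list unique.\<close>

definition term_code :: "nat \<Rightarrow> int_mpoly \<Rightarrow> (nat \<Rightarrow>\<^sub>0 nat) \<Rightarrow> nat" where
  "term_code p D m =
     prod_encode (list_encode (map (Poly_Mapping.lookup m) [1..<Suc p]),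
                  int_encode (Poly_Mapping.lookup D m))"

fun equation_code :: "nat \<times> int_mpoly \<Rightarrow> nat" where
  "equation_code (p, D) =
     prod_encode (p, list_encode (sorted_list_of_set (term_code p D ` Poly_Mapping.keys D)))"

lemma inj_on_equation_code: "inj_on equation_code diophantine_equations"
proof (rule inj_onI)
  fix a b
  assume a: "a \<in> diophantine_equations" and b: "b \<in> diophantine_equations"
    and eq: "equation_code a = equation_code b"
  obtain p D where a': "a = (p, D)" by (cases a)
  obtain q E where b': "b = (q, E)" by (cases b)
  from eq have pq: "p = q" and l: "sorted_list_of_set (term_code p D ` Poly_Mapping.keys D)
      = sorted_list_of_set (term_code q E ` Poly_Mapping.keys E)"
    by (auto simp: a' b' list_encode_eq)
  have img: "term_code p D ` Poly_Mapping.keys D = term_code p E ` Poly_Mapping.keys E"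
    using arg_cong[OF l, of set] pq by simp
  have DE: "Poly_Mapping.keys A \<subseteq> Poly_Mapping.keys B \<and>
      (\<forall>m\<in>Poly_Mapping.keys A. Poly_Mapping.lookup A m = Poly_Mapping.lookup B m)"
    if A: "\<forall>m\<in>Poly_Mapping.keys A. Poly_Mapping.keys m \<subseteq> {1..p}"
      and B: "\<forall>m\<in>Poly_Mapping.keys B. Poly_Mapping.keys m \<subseteq> {1..p}"
      and AB: "term_code p A ` Poly_Mapping.keys A = term_code p B ` Poly_Mapping.keys B"
    for A B :: int_mpoly
  proof -
    have "m \<in> Poly_Mapping.keys B \<and> Poly_Mapping.lookup A m = Poly_Mapping.lookup B m"
      if m: "m \<in> Poly_Mapping.keys A" for m
    proof -
      obtain m' where m': "m' \<in> Poly_Mapping.keys B" "term_code p A m = term_code p B m'"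
        using m AB by (metis imageE imageI)
      then have ex: "map (Poly_Mapping.lookup m) [1..<Suc p] = map (Poly_Mapping.lookup m') [1..<Suc p]"
        and co: "Poly_Mapping.lookup A m = Poly_Mapping.lookup B m'"
        by (simp_all only: term_code_def prod_encode_eq list_encode_eq int_encode_eq prod.inject)
      have "Poly_Mapping.lookup m i = Poly_Mapping.lookup m' i" for i
      proof (cases "i \<in> {1..p}")
        case True
        then show ?thesis using ex by (auto simp del: upt_Suc)
      next
        case False
        then have "i \<notin> Poly_Mapping.keys m" "i \<notin> Poly_Mapping.keys m'"
          using A B m m'(1) by blast+
        then show ?thesis by (simp add: in_keys_iff)
      qed
      then have "m = m'" by (intro poly_mapping_eqI)
      then show ?thesis using m' co by simp
    qed
    then show ?thesis by blast
  qed
  have "\<forall>m\<in>Poly_Mapping.keys D. Poly_Mapping.keys m \<subseteq> {1..p}"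
    "\<forall>m\<in>Poly_Mapping.keys E. Poly_Mapping.keys m \<subseteq> {1..p}"
    using a b pq by (auto simp: a' b' diophantine_equations_def)
  then have "Poly_Mapping.keys D = Poly_Mapping.keys E"
    and "\<forall>m\<in>Poly_Mapping.keys D. Poly_Mapping.lookup D m = Poly_Mapping.lookup E m"
    using DE[of D E] DE[of E D] img by auto
  then have "D = E" by (intro poly_mapping_eqI) (metis in_keys_iff)
  then show "a = b" by (simp add: a' b' pq)
qed

end

theory Submission imports Defs begin

text \<open>
  Addition is expressible by multiplication and successor: for \<open>z > 0\<close>, the equation
  \<open>z = a + b\<close> is equivalent to \<open>(z a + 1) (z b + 1) = z\<^sup>2 (a b + 1) + 1\<close>. An equation
  \<open>D = 0\<close> in positive integers is the same as an equation \<open>L = R\<close> between two expressions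
  built from inputs by additions and multiplications: \<open>L\<close> collects the positive
  and \<open>R\<close> the negative coefficients, and the same positive quantity is added to both sides.
  So introducing one unknown for the value of every subexpression, and a second one for this
  value minus one, which forces the value to be positive, turns \<open>D = 0\<close> into a system
  \<open>S \<subseteq> G_system n\<close>.

  All unknowns of \<open>S\<close> are determined by the inputs. Hence the solutions of \<open>S\<close> in
  non-negative integers correspond bijectively to the solutions of \<open>D = 0\<close> in positive
  integers; one solution set is finite as soon as the other is, and the conjecture bounds the
  inputs by \<open>f_bound (2 * n)\<close> (\<open>solutions_of_expr_equation_bounded\<close>).

  The algorithm never has to construct \<open>S\<close>. Since \<open>f_bound\<close> is monotone, a computable upper
  bound on the number \<open>n\<close> of unknowns suffices. The code \<open>c\<close> of the equation dominates the
  number of variables, the number of terms, every coefficient and every exponent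
  (\<open>equation_code_bounds\<close>), so \<open>2 * n\<close> is at most a polynomial in \<open>c\<close>
  (\<open>cost_half_expr_le\<close>), hence at most \<open>2 ^ (4 * (c + 2))\<close>. The returned bound iterates the
  double exponential that many times, which is primitive recursive in \<open>c\<close>.
\<close>

section \<open>Positive expressions and the systems that define them\<close>

text \<open>Successors are separate from sums because they name the auxiliary quantities by which
  a sum is expressed through products.\<close>

datatype expr = One | Inp nat | Succ expr | Times expr expr | Plus expr expr

fun val :: "(nat \<Rightarrow> nat) \<Rightarrow> expr \<Rightarrow> nat" where
  "val x One = 1"
| "val x (Inp i) = x i"
| "val x (Succ a) = Suc (val x a)"
| "val x (Times a b) = val x a * val x b"
| "val x (Plus a b) = val x a + val x b"

fun inputs :: "expr \<Rightarrow> nat set" where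
  "inputs One = {}"
| "inputs (Inp i) = {i}"
| "inputs (Succ a) = inputs a"
| "inputs (Times a b) = inputs a \<union> inputs b"
| "inputs (Plus a b) = inputs a \<union> inputs b"

lemma val_cong: "(\<And>i. i \<in> inputs e \<Longrightarrow> x i = y i) \<Longrightarrow> val x e = val y e"
  by (induction e) auto

lemma val_pos: "(\<And>i. i \<in> inputs e \<Longrightarrow> 0 < x i) \<Longrightarrow> 0 < val x e"
  by (induction e) auto

text \<open>Both sides contain the terms \<open>z\<^sup>2 a b + 1\<close>; what remains is \<open>z (a + b) = z\<^sup>2\<close>, and
  \<open>z\<close> can be cancelled. This identity is due to Julia Robinson.\<close>

lemma sum_iff_product_identity:
  fixes a b z :: nat
  assumes "0 < z"
  shows "Suc (z * a) * Suc (z * b) = Suc (z * z * Suc (a * b)) \<longleftrightarrow> z = a + b"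
proof -
  have "Suc (z * a) * Suc (z * b) = Suc (z * z * (a * b) + z * (a + b))"
    and "Suc (z * z * Suc (a * b)) = Suc (z * z * (a * b) + z * z)"
    by (simp_all add: algebra_simps)
  then have "Suc (z * a) * Suc (z * b) = Suc (z * z * Suc (a * b)) \<longleftrightarrow> z * (a + b) = z * z"
    by simp
  also have "\<dots> \<longleftrightarrow> z = a + b"
    using assms by auto
  finally show ?thesis .
qed

text \<open>The quantities that occur in the identity above, except \<open>a\<close>, \<open>b\<close> and \<open>z\<close>. They
  contain \<open>Plus a b\<close> itself, so they are not subexpressions of it, and the set of quantities
  named by a system is given by a recursion of its own.\<close>

definition sum_helpers :: "expr \<Rightarrow> expr \<Rightarrow> expr list" where
  "sum_helpers a b = (let z = Plus a b in
     [Times z a, Succ (Times z a), Times z b, Succ (Times z b), Times z z,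
      Times a b, Succ (Times a b), Times (Times z z) (Succ (Times a b)),
      Succ (Times (Times z z) (Succ (Times a b)))])"

fun parts :: "expr \<Rightarrow> expr set" where
  "parts One = {One}"
| "parts (Inp i) = {Inp i}"
| "parts (Succ a) = insert (Succ a) (parts a)"
| "parts (Times a b) = insert (Times a b) (parts a \<union> parts b)"
| "parts (Plus a b) = set (Plus a b # sum_helpers a b) \<union> (parts a \<union> parts b)"

lemma self_in_parts: "e \<in> parts e"
  by (cases e) auto

lemma finite_parts: "finite (parts e)"
  by (induction e) auto

lemma inputs_of_part: "e \<in> parts t \<Longrightarrow> inputs e \<subseteq> inputs t"
  by (induction t) (auto simp: sum_helpers_def Let_def)

lemma Inp_in_parts: "i \<in> inputs t \<Longrightarrow> Inp i \<in> parts t"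
  by (induction t) auto

text \<open>A bound on the number of parts that counts repeated subexpressions every time. It is
  additive, which \<open>card (parts e)\<close> is not.\<close>

fun cost :: "expr \<Rightarrow> nat" where
  "cost One = 1"
| "cost (Inp i) = 1"
| "cost (Succ a) = cost a + 1"
| "cost (Times a b) = cost a + cost b + 1"
| "cost (Plus a b) = cost a + cost b + 10"

lemma card_parts_le_cost: "card (parts e) \<le> cost e"
proof (induction e)
  case (Succ a)
  then show ?case
    using card_insert_le_m1[of "Suc (cost a)" "parts a" "Succ a"] by simp
next
  case (Times a b)
  have "card (parts (Times a b)) \<le> Suc (card (parts a \<union> parts b))"
    by (simp add: card_insert_if finite_parts)
  also have "\<dots> \<le> Suc (card (parts a) + card (parts b))"
    using card_Un_le by auto
  finally show ?case using Times.IH by simp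
next
  case (Plus a b)
  have "card (parts (Plus a b)) \<le>
      card (set (Plus a b # sum_helpers a b)) + card (parts a \<union> parts b)"
    by (simp only: parts.simps card_Un_le)
  also have "\<dots> \<le> 10 + (card (parts a) + card (parts b))"
    using card_length[of "Plus a b # sum_helpers a b"] card_Un_le[of "parts a" "parts b"]
    by (simp add: sum_helpers_def Let_def)
  finally show ?case using Plus.IH by simp
qed simp_all

text \<open>The two unknowns of an expression: its value and its value minus one.\<close>

datatype node = At expr | Below expr

text \<open>The equation that ties the value of an expression to other values; \<open>\<nu>\<close>
  numbers the unknowns. The equation for \<open>One\<close> admits the values 0 and 1, of which positivity excludes 0; the one for
  \<open>Plus\<close> is the product identity, likewise meaningful because \<open>z\<close> is positive.\<close>

fun law :: "(node \<Rightarrow> nat) \<Rightarrow> expr \<Rightarrow> equation set" where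
  "law \<nu> One = {Mult (\<nu> (At One)) (\<nu> (At One)) (\<nu> (At One))}"
| "law \<nu> (Inp i) = {}"
| "law \<nu> (Succ a) = {Incr (\<nu> (At a)) (\<nu> (At (Succ a)))}"
| "law \<nu> (Times a b) = {Mult (\<nu> (At a)) (\<nu> (At b)) (\<nu> (At (Times a b)))}"
| "law \<nu> (Plus a b) = (let z = Plus a b in
     {Mult (\<nu> (At (Succ (Times z a)))) (\<nu> (At (Succ (Times z b))))
        (\<nu> (At (Succ (Times (Times z z) (Succ (Times a b))))))})"

definition system :: "(node \<Rightarrow> nat) \<Rightarrow> expr \<Rightarrow> equation set" where
  "system \<nu> t = (\<Union>e\<in>parts t. insert (Incr (\<nu> (Below e)) (\<nu> (At e))) (law \<nu> e))"

text \<open>The unknowns of a system are functions of its inputs: going up the expression, every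
  law has exactly one solution once the values of the arguments are known. For a sum, the
  helpers are first computed from the still unknown \<open>y (\<nu> (At (Plus a b)))\<close>, and then the
  product identity gives that value.\<close>

lemma system_determines_value:
  assumes "\<And>q. q \<in> system \<nu> t \<Longrightarrow> holds y q" and "e \<in> parts t"
  shows "y (\<nu> (At e)) = val (\<lambda>i. y (\<nu> (At (Inp i)))) e"
  using assms
proof (induction t arbitrary: e)
  case One
  have "y (\<nu> (Below One)) + 1 = y (\<nu> (At One))"
    using One.prems(1)[of "Incr (\<nu> (Below One)) (\<nu> (At One))"] by (auto simp: system_def)
  moreover have "y (\<nu> (At One)) * y (\<nu> (At One)) = y (\<nu> (At One))"
    using One.prems(1)[of "Mult (\<nu> (At One)) (\<nu> (At One)) (\<nu> (At One))"]
    by (auto simp: system_def)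
  ultimately show ?case using One.prems(2) by auto
next
  case (Inp i)
  then show ?case by auto
next
  case (Succ a)
  have a: "y (\<nu> (At u)) = val (\<lambda>i. y (\<nu> (At (Inp i)))) u" if "u \<in> parts a" for u
    using that by (intro Succ.IH Succ.prems(1)) (auto simp: system_def)
  have "y (\<nu> (At a)) + 1 = y (\<nu> (At (Succ a)))"
    using Succ.prems(1)[of "Incr (\<nu> (At a)) (\<nu> (At (Succ a)))"] by (auto simp: system_def)
  then show ?case using a a[OF self_in_parts] Succ.prems(2) by auto
next
  case (Times a b)
  have a: "y (\<nu> (At u)) = val (\<lambda>i. y (\<nu> (At (Inp i)))) u" if "u \<in> parts a" for u
    using that by (intro Times.IH(1) Times.prems(1)) (auto simp: system_def)
  have b: "y (\<nu> (At u)) = val (\<lambda>i. y (\<nu> (At (Inp i)))) u" if "u \<in> parts b" for u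
    using that by (intro Times.IH(2) Times.prems(1)) (auto simp: system_def)
  have "y (\<nu> (At a)) * y (\<nu> (At b)) = y (\<nu> (At (Times a b)))"
    using Times.prems(1)[of "Mult (\<nu> (At a)) (\<nu> (At b)) (\<nu> (At (Times a b)))"]
    by (auto simp: system_def)
  then show ?case
    using a b a[OF self_in_parts] b[OF self_in_parts] Times.prems(2) by auto
next
  case (Plus a b)
  let ?x = "\<lambda>i. y (\<nu> (At (Inp i)))"
  let ?Y = "\<lambda>e. y (\<nu> (At e))"
  let ?z = "Plus a b"
  have a: "y (\<nu> (At u)) = val (\<lambda>i. y (\<nu> (At (Inp i)))) u" if "u \<in> parts a" for u
    using that by (intro Plus.IH(1) Plus.prems(1)) (auto simp: system_def)
  have b: "y (\<nu> (At u)) = val (\<lambda>i. y (\<nu> (At (Inp i)))) u" if "u \<in> parts b" for u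
    using that by (intro Plus.IH(2) Plus.prems(1)) (auto simp: system_def)
  have local: "holds y q" if "u \<in> set (?z # sum_helpers a b)"
    "q \<in> insert (Incr (\<nu> (Below u)) (\<nu> (At u))) (law \<nu> u)" for u q
    using that by (intro Plus.prems(1)) (auto simp: system_def)
  have succ: "?Y (Succ u) = Suc (?Y u)" if "Succ u \<in> set (sum_helpers a b)" for u
    using local[of "Succ u" "Incr (\<nu> (At u)) (\<nu> (At (Succ u)))"] that by simp
  have times: "?Y (Times u v) = ?Y u * ?Y v" if "Times u v \<in> set (sum_helpers a b)" for u v
    using local[of "Times u v" "Mult (\<nu> (At u)) (\<nu> (At v)) (\<nu> (At (Times u v)))"] that by simp
  have pos: "0 < ?Y ?z"
    using local[of ?z "Incr (\<nu> (Below ?z)) (\<nu> (At ?z))"] by simp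
  have "?Y (Succ (Times ?z a)) * ?Y (Succ (Times ?z b)) =
      ?Y (Succ (Times (Times ?z ?z) (Succ (Times a b))))"
    using local[of ?z "Mult (\<nu> (At (Succ (Times ?z a)))) (\<nu> (At (Succ (Times ?z b))))
        (\<nu> (At (Succ (Times (Times ?z ?z) (Succ (Times a b))))))"]
    by (simp add: Let_def)
  then have "Suc (?Y ?z * ?Y a) * Suc (?Y ?z * ?Y b) = Suc (?Y ?z * ?Y ?z * Suc (?Y a * ?Y b))"
    by (simp add: succ times sum_helpers_def Let_def)
  then have z: "?Y ?z = ?Y a + ?Y b"
    using sum_iff_product_identity[OF pos] by blast
  have "?Y u = val ?x u" if "u \<in> set (?z # sum_helpers a b)" for u
    using that z a[OF self_in_parts] b[OF self_in_parts]
    by (auto simp: succ times sum_helpers_def Let_def)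
  then show ?case using a b Plus.prems(2) by auto
qed

text \<open>Conversely every choice of positive inputs extends to a solution. Positivity is what
  makes the truncated subtraction in the value of \<open>Below e\<close> correct.\<close>

lemma values_satisfy_system:
  assumes at: "\<And>e. e \<in> parts t \<Longrightarrow> y (\<nu> (At e)) = val x e"
    and below: "\<And>e. e \<in> parts t \<Longrightarrow> y (\<nu> (Below e)) = val x e - 1"
    and pos: "\<And>i. i \<in> inputs t \<Longrightarrow> 0 < x i"
    and "q \<in> system \<nu> t"
  shows "holds y q"
proof -
  obtain e where e: "e \<in> parts t" "q = Incr (\<nu> (Below e)) (\<nu> (At e)) \<or> q \<in> law \<nu> e"
    using assms(4) by (auto simp: system_def)
  have val_e: "0 < val x e"
    using e(1) pos inputs_of_part by (intro val_pos) blast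
  have "holds y q" if "q \<in> law \<nu> e"
    using at e(1) that
  proof (induction t)
    case (Plus a b)
    have args: "y (\<nu> (At a)) = val x a" "y (\<nu> (At b)) = val x b"
      using Plus.prems(1) self_in_parts by auto
    show ?case
    proof (cases "e \<in> parts a \<union> parts b")
      case True
      then show ?thesis using Plus by auto
    next
      case False
      with Plus.prems(2) have "e \<in> set (Plus a b # sum_helpers a b)" by auto
      then consider "e = Plus a b" | "e \<in> set (sum_helpers a b)" by auto
      then show ?thesis
      proof cases
        case 1
        have at: "y (\<nu> (At u)) = val x u" if "u \<in> set (sum_helpers a b)" for u
          using that Plus.prems(1) by auto
        have "Suc ((i + j) * i) * Suc ((i + j) * j) = Suc ((i + j) * (i + j) * Suc (i * j))"
          for i j :: nat
          by (simp add: algebra_simps)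
        then show ?thesis
          using 1 Plus.prems(3) by (simp add: Let_def at sum_helpers_def)
      next
        case 2
        have at: "y (\<nu> (At u)) = val x u" if "u \<in> set (Plus a b # sum_helpers a b)" for u
          using that Plus.prems(1) by auto
        show ?thesis
          using 2 Plus.prems(3) args by (auto simp: at sum_helpers_def Let_def)
      qed
    qed
  qed (use self_in_parts in auto)
  then show ?thesis using e val_e at below by auto
qed

section \<open>Bounding the solutions of one equation\<close>

lemma f_bound_mono: "m \<le> n \<Longrightarrow> f_bound m \<le> f_bound n"
proof (rule lift_Suc_mono_le[of f_bound])
  show "f_bound k \<le> f_bound (Suc k)" for k
  proof (cases k)
    case (Suc j)
    have "f_bound k \<le> 2 ^ 2 ^ f_bound k"
      using less_trans[OF less_exp less_exp, of "f_bound k"] by (rule less_imp_le)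
    then show ?thesis using Suc by simp
  qed simp
qed

text \<open>The transfer from the conjecture to equations between expressions. The system consists
  of the systems of both sides, with a common unknown for each common part, and of the
  equation \<open>(L - 1) + 1 = R\<close>. Sending a solution to its inputs is injective, so the system has
  finitely many solutions; the given solution \<open>x\<close> extends to one of them. The factor 4 is two
  unknowns for each part, times the 2 in the argument of \<open>f_bound\<close> in the conjecture.\<close>

lemma solutions_of_expr_equation_bounded:
  assumes A: "conjecture_A"
    and I: "inputs L \<union> inputs R = I"
    and fin: "finite {x \<in> I \<rightarrow>\<^sub>E {1..}. val x L = val x R}"
    and x: "x \<in> I \<rightarrow>\<^sub>E {1..}" "val x L = val x R"
    and i: "i \<in> I"
  shows "x i \<le> f_bound (4 * (cost L + cost R))"
proof -
  define P where "P = parts L \<union> parts R"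
  define V where "V = At ` P \<union> Below ` P"
  have finP: "finite P" by (simp add: P_def finite_parts)
  then have finV: "finite V" by (simp add: V_def)
  define n where "n = card V"
  have n_le: "n \<le> 2 * (cost L + cost R)"
  proof -
    have "n \<le> card P + card P"
      unfolding n_def V_def
      using card_Un_le[of "At ` P" "Below ` P"] card_image_le[OF finP, of At]
        card_image_le[OF finP, of Below] by linarith
    moreover have "card P \<le> cost L + cost R"
      unfolding P_def using card_Un_le[of "parts L" "parts R"]
        card_parts_le_cost[of L] card_parts_le_cost[of R] by linarith
    ultimately show ?thesis by simp
  qed
  have LR: "At L \<in> V" "Below L \<in> V" "At R \<in> V"
    by (auto simp: V_def P_def self_in_parts)
  have n1: "1 \<le> n"
    using LR finV by (auto simp: n_def Suc_le_eq card_gt_0_iff)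
  obtain \<nu> where \<nu>: "bij_betw \<nu> V {1..n}"
    using finite_same_card_bij[OF finV finite_atLeastAtMost[of 1 n]] by (auto simp: n_def)
  have \<nu>_range: "\<nu> v \<in> {1..n}" if "v \<in> V" for v
    using that \<nu> bij_betwE by blast
  define S where "S = insert (Incr (\<nu> (Below L)) (\<nu> (At R))) (system \<nu> L \<union> system \<nu> R)"
  have nodes: "At e \<in> V" "Below e \<in> V" if "e \<in> P" for e
    using that by (auto simp: V_def)
  have law_in_G_system: "law \<nu> e \<subseteq> G_system n" if "e \<in> parts t" "parts t \<subseteq> P" for e t
    using that
  proof (induction t)
    case (Plus a b)
    have ab: "a \<in> P" "b \<in> P"
      using Plus.prems(2) self_in_parts by auto
    show ?case
    proof (cases "e \<in> parts a \<union> parts b")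
      case True
      then show ?thesis using Plus by auto
    next
      case False
      with Plus.prems(1) have "e \<in> set (Plus a b # sum_helpers a b)" by auto
      moreover have "\<nu> (At u) \<in> {1..n}" if "u \<in> set (Plus a b # sum_helpers a b)" for u
        using that Plus.prems(2) by (intro \<nu>_range nodes) auto
      moreover have "\<nu> (At a) \<in> {1..n}" "\<nu> (At b) \<in> {1..n}"
        using ab \<nu>_range nodes by blast+
      ultimately show ?thesis
        by (auto simp: sum_helpers_def Let_def G_system_def)
    qed
  qed (use self_in_parts nodes \<nu>_range in \<open>auto simp: G_system_def subset_iff\<close>)
  have S_sub: "S \<subseteq> G_system n"
  proof -
    have "system \<nu> t \<subseteq> G_system n" if t: "parts t \<subseteq> P" for t
      unfolding system_def
    proof (intro UN_least insert_subsetI)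
      fix e assume e: "e \<in> parts t"
      then have "\<nu> (Below e) \<in> {1..n}" "\<nu> (At e) \<in> {1..n}"
        using t nodes \<nu>_range by blast+
      then show "Incr (\<nu> (Below e)) (\<nu> (At e)) \<in> G_system n"
        by (auto simp: G_system_def)
      show "law \<nu> e \<subseteq> G_system n"
        using e t by (rule law_in_G_system)
    qed
    moreover have "Incr (\<nu> (Below L)) (\<nu> (At R)) \<in> G_system n"
      using LR \<nu>_range by (auto simp: G_system_def)
    ultimately show ?thesis by (simp add: S_def P_def)
  qed
  define inp where "inp y = (\<lambda>i\<in>I. y (\<nu> (At (Inp i))))" for y :: "nat \<Rightarrow> nat"
  have inp_node: "At (Inp i) \<in> V" if "i \<in> I" for i
    using that I Inp_in_parts by (auto simp: V_def P_def)
  have sol_val: "y (\<nu> (At e)) = val (inp y) e" "Suc (y (\<nu> (Below e))) = val (inp y) e"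
    if y: "y \<in> nat_solutions n S" and e: "e \<in> P" for y e
  proof -
    have h: "holds y q" if "q \<in> system \<nu> L \<union> system \<nu> R" for q
      using y that by (auto simp: nat_solutions_def S_def)
    have "y (\<nu> (At e)) = val (\<lambda>i. y (\<nu> (At (Inp i)))) e"
      using e h system_determines_value[of \<nu> _ y e] unfolding P_def by blast
    also have "\<dots> = val (inp y) e"
    proof (rule val_cong)
      fix i assume "i \<in> inputs e"
      then have "i \<in> I" using e I inputs_of_part unfolding P_def by blast
      then show "y (\<nu> (At (Inp i))) = inp y i" by (simp add: inp_def)
    qed
    finally show at: "y (\<nu> (At e)) = val (inp y) e" .
    have "holds y (Incr (\<nu> (Below e)) (\<nu> (At e)))"
      using e by (intro h) (auto simp: P_def system_def)
    then show "Suc (y (\<nu> (Below e))) = val (inp y) e" using at by simp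
  qed
  have "finite (nat_solutions n S)"
  proof (rule inj_on_finite[OF _ _ fin])
    show "inj_on inp (nat_solutions n S)"
    proof (rule inj_onI)
      fix y y' assume y: "y \<in> nat_solutions n S" "y' \<in> nat_solutions n S" and eq: "inp y = inp y'"
      have "y k = y' k" if k: "k \<in> {1..n}" for k
      proof -
        obtain v where "v \<in> V" "k = \<nu> v"
          using k bij_betw_imp_surj_on[OF \<nu>] by (metis imageE)
        then obtain e where "e \<in> P" "k = \<nu> (At e) \<or> k = \<nu> (Below e)"
          by (auto simp: V_def)
        then show ?thesis
          using sol_val[OF y(1)] sol_val[OF y(2)] eq by (metis nat.inject)
      qed
      moreover have "y \<in> {1..n} \<rightarrow>\<^sub>E UNIV" "y' \<in> {1..n} \<rightarrow>\<^sub>E UNIV"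
        using y by (auto simp: nat_solutions_def)
      ultimately show "y = y'" by (metis PiE_ext)
    qed
    show "inp ` nat_solutions n S \<subseteq> {x \<in> I \<rightarrow>\<^sub>E {1..}. val x L = val x R}"
    proof clarify
      fix y assume y: "y \<in> nat_solutions n S"
      have "1 \<le> inp y i" if "i \<in> I" for i
      proof -
        have "Inp i \<in> P" using that I Inp_in_parts by (auto simp: P_def)
        then show ?thesis using sol_val(2)[OF y, of "Inp i"] by simp
      qed
      then have "inp y \<in> I \<rightarrow>\<^sub>E {1..}" by (auto simp: inp_def)
      moreover have "holds y (Incr (\<nu> (Below L)) (\<nu> (At R)))"
        using y by (auto simp: nat_solutions_def S_def)
      then have "val (inp y) L = val (inp y) R"
        using sol_val(1)[OF y, of R] sol_val(2)[OF y, of L] self_in_parts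
        by (simp add: P_def)
      ultimately show "inp y \<in> I \<rightarrow>\<^sub>E {1..} \<and> val (inp y) L = val (inp y) R" by blast
    qed
  qed
  then have bound: "y k \<le> f_bound (2 * n)" if "y \<in> nat_solutions n S" "k \<in> {1..n}" for y k
    using A n1 S_sub that unfolding conjecture_A_def by blast
  \<comment> \<open>The solution of the system that extends \<open>x\<close>.\<close>
  define w where "w v = (case v of At e \<Rightarrow> val x e | Below e \<Rightarrow> val x e - 1)" for v
  define y where "y = (\<lambda>k\<in>{1..n}. w (inv_into V \<nu> k))"
  have y_\<nu>: "y (\<nu> v) = w v" if "v \<in> V" for v
    using that \<nu>_range[OF that] \<nu> by (simp add: y_def bij_betw_def)
  have x_pos: "0 < x i" if "i \<in> I" for i
    using x(1) that by (auto simp: PiE_def Pi_def Suc_le_eq)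
  have "holds y q" if q: "q \<in> S" for q
  proof -
    have "holds y q" if "q \<in> system \<nu> t" "t = L \<or> t = R" for t
    proof (rule values_satisfy_system[OF _ _ _ that(1)])
      show "y (\<nu> (At e)) = val x e" "y (\<nu> (Below e)) = val x e - 1" if "e \<in> parts t" for e
        using that \<open>t = L \<or> t = R\<close> nodes[of e] y_\<nu> by (auto simp: P_def w_def)
      show "0 < x i" if "i \<in> inputs t" for i
        using that \<open>t = L \<or> t = R\<close> I x_pos by auto
    qed
    moreover have "0 < val x L" using I x_pos by (intro val_pos) auto
    then have "holds y (Incr (\<nu> (Below L)) (\<nu> (At R)))"
      using x(2) LR y_\<nu> by (simp add: w_def)
    ultimately show ?thesis using q by (auto simp: S_def)
  qed
  then have "y \<in> nat_solutions n S"
    by (auto simp: nat_solutions_def y_def)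
  then have "y (\<nu> (At (Inp i))) \<le> f_bound (2 * n)"
    using bound \<nu>_range inp_node i by blast
  then have "x i \<le> f_bound (2 * n)"
    using y_\<nu>[OF inp_node[OF i]] by (simp add: w_def)
  also have "\<dots> \<le> f_bound (4 * (cost L + cost R))"
    using n_le by (intro f_bound_mono) simp
  finally show ?thesis .
qed

section \<open>Polynomials as differences of positive expressions\<close>

text \<open>A polynomial with non-negative coefficients is a list of words: a word is the product
  of the variables that it lists, and a coefficient is expressed by repetition. The unit at the
  end of \<open>sum_expr\<close> gives even the empty sum a positive value.\<close>

definition product_expr :: "nat list \<Rightarrow> expr" where
  "product_expr xs = foldr (\<lambda>i. Times (Inp i)) xs One"

definition sum_expr :: "nat list list \<Rightarrow> expr" where
  "sum_expr ts = foldr (\<lambda>t. Plus (product_expr t)) ts One"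

lemma val_product_expr: "val x (product_expr t) = (\<Prod>i\<leftarrow>t. x i)"
  by (induction t) (auto simp: product_expr_def)

lemma inputs_product_expr: "inputs (product_expr t) = set t"
  by (induction t) (auto simp: product_expr_def)

lemma cost_product_expr: "cost (product_expr t) = 2 * length t + 1"
  by (induction t) (auto simp: product_expr_def)

lemma val_sum_expr: "val x (sum_expr ts) = (\<Sum>t\<leftarrow>ts. \<Prod>i\<leftarrow>t. x i) + 1"
  by (induction ts) (auto simp: sum_expr_def val_product_expr)

lemma inputs_sum_expr: "inputs (sum_expr ts) = (\<Union>t\<in>set ts. set t)"
  by (induction ts) (auto simp: sum_expr_def inputs_product_expr)

lemma cost_sum_expr: "cost (sum_expr ts) = (\<Sum>t\<leftarrow>ts. 2 * length t + 11) + 1"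
  by (induction ts) (auto simp: sum_expr_def cost_product_expr)

definition monomial_word :: "nat \<Rightarrow> (nat \<Rightarrow>\<^sub>0 nat) \<Rightarrow> nat list" where
  "monomial_word p m = concat (map (\<lambda>i. replicate (Poly_Mapping.lookup m i) i) [1..<Suc p])"

lemma prod_monomial_word:
  fixes x :: "nat \<Rightarrow> nat"
  assumes "Poly_Mapping.keys m \<subseteq> {1..p}"
  shows "(\<Prod>i\<leftarrow>monomial_word p m. x i) =
    (\<Prod>i\<in>Poly_Mapping.keys m. x i ^ Poly_Mapping.lookup m i)"
proof -
  have concat: "(\<Prod>i\<leftarrow>concat (map (\<lambda>i. replicate (g i) i) js). x i) = (\<Prod>i\<leftarrow>js. x i ^ g i)"
    for g and js :: "nat list"
    by (induction js) (auto simp: prod_list_replicate)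
  have "(\<Prod>i\<leftarrow>monomial_word p m. x i) = (\<Prod>i\<leftarrow>[1..<Suc p]. x i ^ Poly_Mapping.lookup m i)"
    unfolding monomial_word_def by (rule concat)
  also have "\<dots> = (\<Prod>i\<in>{1..p}. x i ^ Poly_Mapping.lookup m i)"
    by (subst prod.distinct_set_conv_list[symmetric]) (auto intro!: prod.cong)
  also have "\<dots> = (\<Prod>i\<in>Poly_Mapping.keys m. x i ^ Poly_Mapping.lookup m i)"
    using assms by (intro prod.mono_neutral_right) (auto simp: in_keys_iff)
  finally show ?thesis .
qed

lemma set_monomial_word: "set (monomial_word p m) \<subseteq> {1..p}"
  by (auto simp: monomial_word_def)

lemma length_monomial_word_le:
  assumes "\<And>i. i \<in> {1..p} \<Longrightarrow> Poly_Mapping.lookup m i \<le> c"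
  shows "length (monomial_word p m) \<le> p * c"
proof -
  have "length (monomial_word p m) = (\<Sum>i\<leftarrow>[1..<Suc p]. Poly_Mapping.lookup m i)"
    by (simp add: monomial_word_def length_concat comp_def del: upt_Suc)
  also have "\<dots> \<le> (\<Sum>i\<leftarrow>[1..<Suc p]. c)"
    using assms by (intro sum_list_mono) auto
  finally show ?thesis by (simp add: sum_list_triv del: upt_Suc)
qed

text \<open>Since \<open>nat\<close> sends negative integers to 0, only the terms whose coefficient has the sign
  \<open>s\<close> contribute. The list \<open>ms\<close> is any enumeration of the monomials of \<open>D\<close>.\<close>

definition signed_words :: "int \<Rightarrow> nat \<Rightarrow> int_mpoly \<Rightarrow> (nat \<Rightarrow>\<^sub>0 nat) list \<Rightarrow> nat list list" where
  "signed_words s p D ms =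
     concat (map (\<lambda>m. replicate (nat (s * Poly_Mapping.lookup D m)) (monomial_word p m)) ms)"

text \<open>For \<open>s = 1\<close> and \<open>s = - 1\<close> these are the two sides of the equation. The word that
  lists every variable once is added to both sides, so that all \<open>p\<close> variables are inputs, even
  those that do not occur in \<open>D\<close>.\<close>

definition half_expr :: "int \<Rightarrow> nat \<Rightarrow> int_mpoly \<Rightarrow> (nat \<Rightarrow>\<^sub>0 nat) list \<Rightarrow> expr" where
  "half_expr s p D ms = sum_expr ([1..<Suc p] # signed_words s p D ms)"

lemma inputs_half_expr: "inputs (half_expr s p D ms) = {1..p}"
  using set_monomial_word
  by (auto simp: half_expr_def inputs_sum_expr signed_words_def split: if_splits simp del: upt_Suc)
    (fastforce simp del: upt_Suc)+

lemma sum_signed_words: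
  fixes f :: "nat list \<Rightarrow> nat"
  shows "(\<Sum>t\<leftarrow>signed_words s p D ms. f t) =
    (\<Sum>m\<leftarrow>ms. nat (s * Poly_Mapping.lookup D m) * f (monomial_word p m))"
  by (induction ms) (auto simp: signed_words_def sum_list_replicate)

lemma half_expr_eq_iff_root:
  assumes D: "(p, D) \<in> diophantine_equations"
    and ms: "distinct ms" "set ms = Poly_Mapping.keys D"
  shows "val x (half_expr 1 p D ms) = val x (half_expr (- 1) p D ms) \<longleftrightarrow>
    eval_mpoly D (\<lambda>i. int (x i)) = 0"
proof -
  define h where "h s = (\<Sum>m\<in>Poly_Mapping.keys D. nat (s * Poly_Mapping.lookup D m) *
      (\<Prod>i\<in>Poly_Mapping.keys m. x i ^ Poly_Mapping.lookup m i))" for s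
  have words: "(\<Prod>i\<leftarrow>monomial_word p m. x i) =
      (\<Prod>i\<in>Poly_Mapping.keys m. x i ^ Poly_Mapping.lookup m i)"
    if "m \<in> Poly_Mapping.keys D" for m
    using D that by (intro prod_monomial_word) (auto simp: diophantine_equations_def)
  have "(\<Sum>t\<leftarrow>signed_words s p D ms. \<Prod>i\<leftarrow>t. x i) = h s" for s
    unfolding sum_signed_words h_def
    using ms words by (simp add: sum_list_distinct_conv_sum_set)
  then have "val x (half_expr s p D ms) = (\<Prod>i\<leftarrow>[1..<Suc p]. x i) + h s + 1" for s
    by (simp add: half_expr_def val_sum_expr del: upt_Suc)
  then have "val x (half_expr 1 p D ms) = val x (half_expr (- 1) p D ms) \<longleftrightarrow> h 1 = h (- 1)"
    by simp
  also have "\<dots> \<longleftrightarrow> int (h 1) - int (h (- 1)) = 0"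
    by simp
  also have "int (h 1) - int (h (- 1)) = eval_mpoly D (\<lambda>i. int (x i))"
    unfolding h_def eval_mpoly_def of_nat_sum sum_subtractf[symmetric]
    by (intro sum.cong) (auto simp: algebra_simps)
  finally show ?thesis .
qed

text \<open>There are at most \<open>c\<close> monomials, each repeated at most \<open>c\<close> times as a word of length at
  most \<open>c\<^sup>2\<close>, whence the fourth power.\<close>

lemma cost_half_expr_le:
  assumes p: "p \<le> c" and len: "length ms \<le> c"
    and coeff: "\<And>m. m \<in> set ms \<Longrightarrow> \<bar>Poly_Mapping.lookup D m\<bar> \<le> int c"
    and expo: "\<And>m i. m \<in> set ms \<Longrightarrow> i \<in> {1..p} \<Longrightarrow> Poly_Mapping.lookup m i \<le> c"
    and s: "\<bar>s\<bar> = 1"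
  shows "cost (half_expr s p D ms) \<le> 12 * (c + 1) ^ 4"
proof -
  have "(\<Sum>t\<leftarrow>signed_words s p D ms. 2 * length t + 11) \<le> (\<Sum>m\<leftarrow>ms. c * (2 * (c * c) + 11))"
    unfolding sum_signed_words
  proof (intro sum_list_mono mult_le_mono add_le_mono)
    fix m assume m: "m \<in> set ms"
    have "s * Poly_Mapping.lookup D m \<le> \<bar>s * Poly_Mapping.lookup D m\<bar>" by simp
    also have "\<dots> \<le> int c" using coeff[OF m] s by (simp add: abs_mult)
    finally show "nat (s * Poly_Mapping.lookup D m) \<le> c" by simp
    have "length (monomial_word p m) \<le> p * c"
      using expo[OF m] by (rule length_monomial_word_le)
    also have "\<dots> \<le> c * c" using p by simp
    finally show "length (monomial_word p m) \<le> c * c" .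
  qed simp_all
  also have "\<dots> = length ms * (c * (2 * (c * c) + 11))"
    by (simp add: sum_list_triv)
  also have "\<dots> \<le> c * (c * (2 * (c * c) + 11))"
    using len by (rule mult_le_mono1)
  finally have "cost (half_expr s p D ms) \<le> 2 * c + 12 + c * (c * (2 * (c * c) + 11))"
    using p by (simp add: half_expr_def cost_sum_expr del: upt_Suc)
  also have "\<dots> \<le> 12 * (c + 1) ^ 4"
    by (simp add: power4_eq_xxxx algebra_simps)
  finally show ?thesis .
qed

section \<open>Reading size bounds off the code\<close>

lemma mem_le_list_encode: "a \<in> set as \<Longrightarrow> a \<le> list_encode as"
proof (induction as)
  case (Cons b as)
  have "b \<le> prod_encode (b, list_encode as)" "list_encode as \<le> prod_encode (b, list_encode as)"
    by (rule le_prod_encode_1 le_prod_encode_2)+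
  then show ?case using Cons by fastforce
qed simp

lemma length_le_list_encode: "length as \<le> list_encode as"
proof (induction as)
  case (Cons b as)
  then show ?case using le_prod_encode_2[of "list_encode as" b] by simp
qed simp

lemma abs_le_int_encode: "\<bar>k\<bar> \<le> int (int_encode k)"
  by (auto simp: int_encode_def sum_encode_def)

text \<open>The pairing and list codings are increasing in each component, so a code dominates
  everything from which it is built. The number of terms is bounded by the length of the coded
  list, in which no term is lost, because distinct monomials have distinct term codes.\<close>

lemma equation_code_bounds:
  assumes "(p, D) \<in> diophantine_equations"
  defines "c \<equiv> equation_code (p, D)"
  shows "p \<le> c" and "card (Poly_Mapping.keys D) \<le> c"
    and "m \<in> Poly_Mapping.keys D \<Longrightarrow> \<bar>Poly_Mapping.lookup D m\<bar> \<le> int c"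
    and "m \<in> Poly_Mapping.keys D \<Longrightarrow> i \<in> {1..p} \<Longrightarrow> Poly_Mapping.lookup m i \<le> c"
proof -
  define T where "T = term_code p D ` Poly_Mapping.keys D"
  have finT: "finite T" by (simp add: T_def)
  have list_le: "list_encode (sorted_list_of_set T) \<le> c"
    by (simp add: c_def T_def le_prod_encode_2)
  show "p \<le> c" by (simp add: c_def le_prod_encode_1)
  have inj: "inj_on (term_code p D) (Poly_Mapping.keys D)"
  proof (rule inj_onI)
    fix m m' assume m: "m \<in> Poly_Mapping.keys D" "m' \<in> Poly_Mapping.keys D"
      and "term_code p D m = term_code p D m'"
    then have eq: "map (Poly_Mapping.lookup m) [1..<Suc p] = map (Poly_Mapping.lookup m') [1..<Suc p]"
      by (simp only: term_code_def prod_encode_eq list_encode_eq prod.inject)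
    show "m = m'"
    proof (rule poly_mapping_eqI)
      fix i
      show "Poly_Mapping.lookup m i = Poly_Mapping.lookup m' i"
      proof (cases "i \<in> {1..p}")
        case True
        then show ?thesis using eq by (auto simp del: upt_Suc)
      next
        case False
        then have "i \<notin> Poly_Mapping.keys m" "i \<notin> Poly_Mapping.keys m'"
          using assms(1) m by (fastforce simp: diophantine_equations_def)+
        then show ?thesis by (simp add: in_keys_iff)
      qed
    qed
  qed
  have "card (Poly_Mapping.keys D) = length (sorted_list_of_set T)"
    by (simp add: T_def card_image[OF inj])
  also have "\<dots> \<le> c" using length_le_list_encode list_le le_trans by blast
  finally show "card (Poly_Mapping.keys D) \<le> c" .
  have term_le: "term_code p D m \<le> c" if "m \<in> Poly_Mapping.keys D" for m
    using that finT mem_le_list_encode[of "term_code p D m" "sorted_list_of_set T"] list_le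
    by (simp add: T_def)
  show "\<bar>Poly_Mapping.lookup D m\<bar> \<le> int c" if m: "m \<in> Poly_Mapping.keys D"
  proof -
    have "int_encode (Poly_Mapping.lookup D m) \<le> c"
      using term_le[OF m] le_prod_encode_2 le_trans unfolding term_code_def by blast
    then show ?thesis using abs_le_int_encode[of "Poly_Mapping.lookup D m"] by linarith
  qed
  show "Poly_Mapping.lookup m i \<le> c" if m: "m \<in> Poly_Mapping.keys D" and i: "i \<in> {1..p}"
  proof -
    have "Poly_Mapping.lookup m i \<le> list_encode (map (Poly_Mapping.lookup m) [1..<Suc p])"
      using i by (intro mem_le_list_encode) (auto simp del: upt_Suc)
    also have "\<dots> \<le> c"
      using term_le[OF m] le_prod_encode_1 le_trans unfolding term_code_def by blast
    finally show ?thesis .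
  qed
qed

section \<open>Computability of the bound\<close>

definition unary_computable :: "(nat \<Rightarrow> nat) \<Rightarrow> bool" where
  "unary_computable f \<longleftrightarrow> (\<exists>r. \<forall>a. rec_eval r [a] (f a))"

lemma unary_computable_Suc: "unary_computable Suc"
  unfolding unary_computable_def using rec_eval.Successor by blast

lemma rec_eval_Comp_single: "rec_eval g xs y \<Longrightarrow> rec_eval f [y] z \<Longrightarrow> rec_eval (Comp f [g]) xs z"
  by (rule rec_eval.Comp[where ys = "[y]"]) auto

lemma unary_computable_comp:
  "unary_computable f \<Longrightarrow> unary_computable g \<Longrightarrow> unary_computable (\<lambda>a. f (g a))"
  unfolding unary_computable_def using rec_eval_Comp_single by metis

lemma rec_eval_constant: "\<exists>r. rec_eval r [] k"
proof (induction k)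
  case 0
  show ?case using rec_eval.Zero by blast
next
  case (Suc k)
  then show ?case using rec_eval_Comp_single rec_eval.Successor by blast
qed

text \<open>Iteration is the only use of primitive recursion: doubling, powers of two and
  \<open>f_bound\<close> are iterates of successor, doubling and the double exponential.\<close>

lemma unary_computable_funpow:
  assumes "unary_computable f"
  shows "unary_computable (\<lambda>n. (f ^^ n) k)"
proof -
  obtain r where r: "\<And>a. rec_eval r [a] (f a)"
    using assms by (auto simp: unary_computable_def)
  obtain z where z: "rec_eval z [] k"
    using rec_eval_constant by blast
  have step: "rec_eval (Comp r [Proj 1]) [n, y] (f y)" for n y
    using rec_eval.Proj[of 1 "[n, y]"] r by (intro rec_eval_Comp_single[of _ _ y]) auto
  have "rec_eval (PrimRec z (Comp r [Proj 1])) [n] ((f ^^ n) k)" for n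
  proof (induction n)
    case 0
    show ?case using rec_eval.PrimRec_0[OF z] by simp
  next
    case (Suc n)
    show ?case using rec_eval.PrimRec_Suc[OF Suc step] by simp
  qed
  then show ?thesis by (auto simp: unary_computable_def)
qed

lemma unary_computable_double: "unary_computable (\<lambda>n. 2 * n)"
proof -
  have "((\<lambda>a. Suc (Suc a)) ^^ n) 0 = 2 * n" for n by (induction n) auto
  then show ?thesis
    using unary_computable_funpow[OF unary_computable_comp[OF unary_computable_Suc unary_computable_Suc], of 0]
    by simp
qed

lemma unary_computable_exp2: "unary_computable (\<lambda>n. 2 ^ n)"
proof -
  have "((\<lambda>a::nat. 2 * a) ^^ n) 1 = 2 ^ n" for n by (induction n) auto
  then show ?thesis
    using unary_computable_funpow[OF unary_computable_double, of 1] by simp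
qed

lemma unary_computable_f_bound_Suc: "unary_computable (\<lambda>n. f_bound (Suc n))"
proof -
  have "((\<lambda>a::nat. 2 ^ 2 ^ a) ^^ n) 1 = f_bound (Suc n)" for n by (induction n) auto
  then show ?thesis
    using unary_computable_funpow[OF unary_computable_comp[OF unary_computable_exp2 unary_computable_exp2], of 1]
    by simp
qed

definition bound_from_code :: "nat \<Rightarrow> nat" where
  "bound_from_code c = f_bound (Suc (2 ^ (2 * (2 * Suc (Suc c)))))"

text \<open>The factor 2 is the effect of \<open>int_encode\<close> on non-negative integers.\<close>

lemma unary_computable_bound_from_code: "unary_computable (\<lambda>c. 2 * bound_from_code c)"
  unfolding bound_from_code_def
  by (intro unary_computable_comp[OF unary_computable_double]
      unary_computable_comp[OF unary_computable_f_bound_Suc]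
      unary_computable_comp[OF unary_computable_exp2]
      unary_computable_comp[OF unary_computable_Suc] unary_computable_Suc)

text \<open>The bound for expressions, applied to the two halves of \<open>D\<close>. What has to be
  bridged is that the solutions of \<open>D = 0\<close> are integer tuples and the inputs of expressions are
  natural numbers; for positive entries the two kinds of tuples correspond to each other. The
  exponent in \<open>bound_from_code\<close> comes from \<open>c + 1 \<le> 2 ^ c\<close> and from the constant
  \<open>4 * (12 + 12) \<le> 2 ^ 8\<close>.\<close>

lemma positive_solutions_bounded:
  assumes A: "conjecture_A" and D: "(p, D) \<in> diophantine_equations"
    and fin: "finite (pos_solutions (p, D))"
    and x: "x \<in> pos_solutions (p, D)" and i: "i \<in> {1..p}"
  shows "x i \<le> int (bound_from_code (equation_code (p, D)))"
proof -
  define c where "c = equation_code (p, D)"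
  obtain ms where ms: "distinct ms" "set ms = Poly_Mapping.keys D"
    using finite_distinct_list[OF finite_keys[of D]] by metis
  let ?L = "half_expr 1 p D ms" and ?R = "half_expr (- 1) p D ms"
  have cost: "cost (half_expr s p D ms) \<le> 12 * (c + 1) ^ 4" if "\<bar>s\<bar> = 1" for s
  proof (rule cost_half_expr_le)
    note bounds = equation_code_bounds[OF D, folded c_def]
    show "p \<le> c" by (rule bounds(1))
    show "length ms \<le> c" using bounds(2) ms distinct_card by metis
    show "\<bar>Poly_Mapping.lookup D m\<bar> \<le> int c" if "m \<in> set ms" for m
      using that ms(2) bounds(3) by blast
    show "Poly_Mapping.lookup m k \<le> c" if "m \<in> set ms" "k \<in> {1..p}" for m k
      using that ms(2) bounds(4) by blast
    show "\<bar>s\<bar> = 1" by (rule that)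
  qed
  have eval_cong: "eval_mpoly D u = eval_mpoly D v" if "\<And>i. i \<in> {1..p} \<Longrightarrow> u i = v i" for u v
    unfolding eval_mpoly_def using D that
    by (intro sum.cong prod.cong arg_cong2[of _ _ _ _ "(*)"] refl)
      (auto simp: diophantine_equations_def subset_iff)
  define X where "X = {u \<in> {1..p} \<rightarrow>\<^sub>E {1..}. val u ?L = val u ?R}"
  define to_int where "to_int u = (\<lambda>i\<in>{1..p}. int (u i))" for u :: "nat \<Rightarrow> nat"
  have "finite X"
  proof (rule inj_on_finite[OF _ _ fin])
    show "inj_on to_int X"
    proof (rule inj_onI)
      fix u v assume uv: "u \<in> X" "v \<in> X" and eq: "to_int u = to_int v"
      have "u k = v k" if "k \<in> {1..p}" for k
        using fun_cong[OF eq, of k] that by (simp add: to_int_def)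
      moreover have "u \<in> {1..p} \<rightarrow>\<^sub>E {1..}" "v \<in> {1..p} \<rightarrow>\<^sub>E {1..}"
        using uv by (auto simp: X_def)
      ultimately show "u = v" by (metis PiE_ext)
    qed
    show "to_int ` X \<subseteq> pos_solutions (p, D)"
    proof clarify
      fix u assume u: "u \<in> X"
      then have "eval_mpoly D (\<lambda>i. int (u i)) = 0"
        using half_expr_eq_iff_root[OF D ms] by (simp add: X_def)
      then have "eval_mpoly D (to_int u) = 0"
        using eval_cong[of "to_int u" "\<lambda>i. int (u i)"] by (simp add: to_int_def)
      moreover have "to_int u \<in> {1..p} \<rightarrow>\<^sub>E {1..}"
        using u by (auto simp: to_int_def X_def PiE_def Pi_def)
      ultimately show "to_int u \<in> pos_solutions (p, D)" by simp
    qed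
  qed
  define u where "u = (\<lambda>i\<in>{1..p}. nat (x i))"
  have x_pos: "1 \<le> x k" if "k \<in> {1..p}" for k
    using x that by (auto simp: PiE_def Pi_def)
  have u_pos: "u \<in> {1..p} \<rightarrow>\<^sub>E {1..}"
    using x_pos nat_mono[of 1] by (auto simp: u_def)
  have "eval_mpoly D (\<lambda>i. int (u i)) = eval_mpoly D x"
    using x_pos by (intro eval_cong) (fastforce simp: u_def intro: order_trans[of 0 1])
  then have u_sol: "val u ?L = val u ?R"
    using half_expr_eq_iff_root[OF D ms] x by simp
  have "u i \<le> f_bound (4 * (cost ?L + cost ?R))"
    using solutions_of_expr_equation_bounded[OF A _ \<open>finite X\<close>[unfolded X_def] u_pos u_sol i]
    by (simp add: inputs_half_expr)
  also have "\<dots> \<le> f_bound (Suc (2 ^ (2 * (2 * Suc (Suc c)))))"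
  proof (rule f_bound_mono)
    have "4 * (cost ?L + cost ?R) \<le> 2 ^ 8 * (c + 1) ^ 4"
      using cost[of 1] cost[of "- 1"] by simp
    also have "\<dots> \<le> 2 ^ 8 * (2 ^ c) ^ 4"
      using less_exp[of c] by (intro mult_le_mono2 power_mono) (auto simp: Suc_le_eq)
    also have "\<dots> = 2 ^ (2 * (2 * Suc (Suc c)))"
      by (simp flip: power_mult power_add add: algebra_simps)
    finally show "4 * (cost ?L + cost ?R) \<le> Suc (2 ^ (2 * (2 * Suc (Suc c))))" by simp
  qed
  finally have "u i \<le> bound_from_code c" by (simp add: bound_from_code_def)
  then show ?thesis using i by (simp add: u_def c_def del: equation_code.simps)
qed

theorem theorem2:
  assumes "conjecture_A"
  shows "\<exists>B :: nat \<times> int_mpoly \<Rightarrow> int.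
    computable_on diophantine_equations equation_code int_encode B \<and>
    (\<forall>(p, D) \<in> diophantine_equations.
       finite (pos_solutions (p, D)) \<longrightarrow>
       (\<forall>x \<in> pos_solutions (p, D). \<forall>i \<in> {1..p}. x i \<le> B (p, D)))"
proof (intro exI conjI)
  let ?B = "\<lambda>E. int (bound_from_code (equation_code E))"
  have "int_encode (int k) = 2 * k" for k
    by (simp add: int_encode_def sum_encode_def)
  then show "computable_on diophantine_equations equation_code int_encode ?B"
    using unary_computable_bound_from_code
    by (auto simp: computable_on_def unary_computable_def simp del: equation_code.simps)
  show "\<forall>(p, D) \<in> diophantine_equations. finite (pos_solutions (p, D)) \<longrightarrow>
      (\<forall>x \<in> pos_solutions (p, D). \<forall>i \<in> {1..p}. x i \<le> ?B (p, D))"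
    using positive_solutions_bounded[OF assms] by blast
qed

end
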